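(* Let $G$ be a subgroup of $PL_o(I)$ and let $n\geq 0$ be an integer. Then $G$ is solvable with derived length $n$ if and only if $G$ has depth $n$.
   Context: $PL_o(I)$ is the group of orientation-preserving piecewise-linear homeomorphisms of $I=[0,1]$ with finitely many breaks in slope; elements act on the right ($x\mapsto xg$). The support of $g$ is the open set of points moved by $g$; an orbital of $g$ is a connected component of its support. A signed orbital of $G$ is a pair $(A,g)$ with $g\in G$ and $A$ an orbital of $g$. A tower of $G$ is a set $T$ of signed orbitals of $G$ such that no two elements of $T$ have the same orbital and the orbitals of the elements of $T$ are pairwise comparable under inclusion (equivalently, $T$ is a chain in the partial order on signed orbitals given lexicographically by inclusion of orbitals and then a total order on $PL_o(I)$, with each orbital occurring at most once). The height of a tower is its cardinality, and the depth of $G$ is the supremum of the heights of the towers of $G$. The trivial group has derived length $0$. *)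

theory Defs
  imports "HOL-Analysis.Analysis" "HOL-Algebra.Solvable_Groups" "HOL-Library.Extended_Nat"
begin

definition PLo :: "(real \<Rightarrow> real) set" where
  "PLo = {f. (\<forall>x. x \<notin> {0..1} \<longrightarrow> f x = x) \<and> f 0 = 0 \<and> f 1 = 1 \<and>
              strict_mono_on {0..1} f \<and>
              (\<exists>B. finite B \<and>
                 (\<forall>x\<in>{0..1}. \<forall>y\<in>{0..1}. x < y \<and> {x<..<y} \<inter> B = {} \<longrightarrow>
                    (\<exists>m c. \<forall>z\<in>{x..y}. f z = m * z + c)))}"

text \<open>Right action: x(gh) = (xg)h, so the product g h is the composition h \<circ> g.\<close>
definition PLo_group :: "(real \<Rightarrow> real) monoid" where
  "PLo_group = \<lparr>carrier = PLo, mult = (\<lambda>g h. h \<circ> g), one = id\<rparr>"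

definition supp :: "(real \<Rightarrow> real) \<Rightarrow> real set" where
  "supp g = {x. g x \<noteq> x}"

definition orbitals :: "(real \<Rightarrow> real) \<Rightarrow> real set set" where
  "orbitals g = {connected_component_set (supp g) x | x. x \<in> supp g}"

definition signed_orbital :: "(real \<Rightarrow> real) set \<Rightarrow> real set \<times> (real \<Rightarrow> real) \<Rightarrow> bool" where
  "signed_orbital G p \<longleftrightarrow> snd p \<in> G \<and> fst p \<in> orbitals (snd p)"

definition tower :: "(real \<Rightarrow> real) set \<Rightarrow> (real set \<times> (real \<Rightarrow> real)) set \<Rightarrow> bool" where
  "tower G T \<longleftrightarrow> (\<forall>p\<in>T. signed_orbital G p) \<and>
     (\<forall>p\<in>T. \<forall>q\<in>T. fst p = fst q \<longrightarrow> p = q) \<and>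
     (\<forall>p\<in>T. \<forall>q\<in>T. fst p \<subseteq> fst q \<or> fst q \<subseteq> fst p)"

definition height :: "'a set \<Rightarrow> enat" where
  "height T = (if finite T then enat (card T) else \<infinity>)"

definition depth :: "(real \<Rightarrow> real) set \<Rightarrow> enat" where
  "depth G = (SUP T \<in> {T. tower G T}. height T)"

definition has_derived_length :: "(real \<Rightarrow> real) set \<Rightarrow> nat \<Rightarrow> bool" where
  "has_derived_length G n \<longleftrightarrow>
     (derived PLo_group ^^ n) G = {id} \<and> (\<forall>k<n. (derived PLo_group ^^ k) G \<noteq> {id})"

end

theory Submission
  imports Defs
begin

text \<open>
  Both conditions are compared through one equivalence: the n-th derived subgroup of G is
  non-trivial iff G has a tower of height n + 1. Call two orbitals (a, b) and (c, d) of
  elements of G crossing if a < c < b < d.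

  If G has crossing orbitals, let J be the component of the union of their two supports
  containing them. The derived subgroup K of the stabilizer of J is trivial near the
  ends of J, since germs at a common fixed point are linear and commute, and K fixes no point of J.
  The latter property passes to all further derived subgroups, so none is trivial; and every compact
  part of J lies in an orbital of a single element of K, which yields towers of every height.

  Without crossing orbitals, an orbital properly contained in another one is an orbital of a
  commutator, so derivation loses at most the top of a tower; conversely an
  orbital of an element of the derived subgroup is properly contained in an orbital of G, as otherwise
  G would fix its left endpoint and the element would be trivial near it.
\<close>

subsection \<open>The group of piecewise-linear homeomorphisms\<close>

text \<open>The finite set is a parameter because closure under composition and inversion is shown
  by exhibiting one. It may contain points that are not breaks.\<close>

definition piecewise_affine_on :: "real set \<Rightarrow> (real \<Rightarrow> real) \<Rightarrow> bool" where
  "piecewise_affine_on B f \<longleftrightarrow> finite B \<and>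
     (\<forall>x\<in>{0..1}. \<forall>y\<in>{0..1}. x < y \<and> {x<..<y} \<inter> B = {} \<longrightarrow>
        (\<exists>m c. \<forall>z\<in>{x..y}. f z = m * z + c))"

lemma PLo_iff:
  "f \<in> PLo \<longleftrightarrow> (\<forall>x. x \<notin> {0..1} \<longrightarrow> f x = x) \<and> f 0 = 0 \<and> f 1 = 1 \<and>
     strict_mono_on {0..1} f \<and> (\<exists>B. piecewise_affine_on B f)"
  by (auto simp: PLo_def piecewise_affine_on_def)

lemma PLo_outside:
  assumes "f \<in> PLo" "x \<le> 0 \<or> 1 \<le> x"
  shows "f x = x"
  using assms by (cases "x = 0 \<or> x = 1") (auto simp: PLo_iff)

text \<open>Since [0,1] is mapped into itself and all other points are fixed, monotonicity extends
  to the whole line, and later comparisons need no range conditions.\<close>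

lemma PLo_strict_mono:
  assumes "f \<in> PLo"
  shows "strict_mono f"
proof (rule strict_monoI)
  fix x y :: real
  assume "x < y"
  have mono: "f u < f v" if "u \<in> {0..1}" "v \<in> {0..1}" "u < v" for u v
    using assms that by (auto simp: PLo_iff strict_mono_on_def)
  have bounds: "0 \<le> f u" "f u \<le> 1" if "u \<in> {0..1}" for u
    using that mono[of 0 u] mono[of u 1] PLo_outside[OF assms, of 0] PLo_outside[OF assms, of 1]
    by (cases "u = 0"; cases "u = 1"; force)+
  consider "x \<in> {0..1}" "y \<in> {0..1}" | "x < 0" "y \<in> {0..1}" | "x \<in> {0..1}" "1 < y"
    | "x \<notin> {0..1}" "y \<notin> {0..1}"
    using \<open>x < y\<close> by fastforce
  then show "f x < f y"
  proof cases
    case 1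
    then show ?thesis using mono \<open>x < y\<close> by blast
  next
    case 2
    then show ?thesis using bounds(1)[of y] PLo_outside[OF assms, of x] by simp
  next
    case 3
    then show ?thesis using bounds(2)[of x] PLo_outside[OF assms, of y] by simp
  next
    case 4
    then show ?thesis
      using \<open>x < y\<close> PLo_outside[OF assms, of x] PLo_outside[OF assms, of y] by auto
  qed
qed

lemma PLo_less_iff: "f \<in> PLo \<Longrightarrow> f x < f y \<longleftrightarrow> x < y"
  by (simp add: PLo_strict_mono strict_mono_less)

lemma PLo_le_iff: "f \<in> PLo \<Longrightarrow> f x \<le> f y \<longleftrightarrow> x \<le> y"
  by (simp add: PLo_strict_mono strict_mono_less_eq)

lemma PLo_eq_iff: "f \<in> PLo \<Longrightarrow> f x = f y \<longleftrightarrow> x = y"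
  by (simp add: PLo_strict_mono strict_mono_eq)

section \<open>One-sided affine germs and continuity\<close>

lemma finite_gap_right:
  fixes x y :: real
  assumes "finite B" "x < y"
  obtains z where "x < z" "z \<le> y" "{x<..<z} \<inter> B = {}"
proof
  let ?S = "insert y (B \<inter> {x<..})"
  have *: "finite ?S" "?S \<noteq> {}" using assms by auto
  show "x < Min ?S" using assms * by (subst Min_gr_iff) auto
  show "Min ?S \<le> y" using * by auto
  have "Min ?S \<le> b" if "b \<in> B" "x < b" for b
    using that * by (intro Min_le) auto
  then show "{x<..<Min ?S} \<inter> B = {}" by fastforce
qed

lemma finite_gap_left:
  fixes x y :: real
  assumes "finite B" "y < x"
  obtains z where "y \<le> z" "z < x" "{z<..<x} \<inter> B = {}"
proof
  let ?S = "insert y (B \<inter> {..<x})"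
  have *: "finite ?S" "?S \<noteq> {}" using assms by auto
  show "Max ?S < x" using assms * by (subst Max_less_iff) auto
  show "y \<le> Max ?S" using * by auto
  have "b \<le> Max ?S" if "b \<in> B" "b < x" for b
    using that * by (intro Max_ge) auto
  then show "{Max ?S<..<x} \<inter> B = {}" by fastforce
qed

text \<open>For \<open>x\<close> in [0,1) a break-free interval to the right of \<open>x\<close>
  lies in one affine piece. Elsewhere the element is the identity just to the right of
  \<open>x\<close>, with slope 1.\<close>

lemma PLo_germ_right:
  assumes "f \<in> PLo"
  shows "\<exists>m. \<forall>\<^sub>F z in at_right x. f z = f x + m * (z - x)"
proof -
  consider "x < 0" | "0 \<le> x" "x < 1" | "1 \<le> x" by linarith
  then show ?thesis
  proof cases
    case 1
    then have "\<forall>\<^sub>F z in at_right x. f z = f x + 1 * (z - x)"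
      unfolding eventually_at_right_field using PLo_outside[OF assms] by (intro exI[of _ 0]) auto
    then show ?thesis by blast
  next
    case 2
    obtain B where B: "piecewise_affine_on B f" using assms by (auto simp: PLo_iff)
    then obtain y where y: "x < y" "y \<le> 1" "{x<..<y} \<inter> B = {}"
      using finite_gap_right[of B x 1] 2 unfolding piecewise_affine_on_def by blast
    moreover have "x \<in> {0..1}" "y \<in> {0..1}" using 2 y by auto
    ultimately obtain m c where mc: "\<forall>z\<in>{x..y}. f z = m * z + c"
      using B unfolding piecewise_affine_on_def by blast
    have "\<forall>\<^sub>F z in at_right x. f z = f x + m * (z - x)"
      unfolding eventually_at_right_field using y mc
      by (intro exI[of _ y]) (auto simp: algebra_simps)
    then show ?thesis by blast
  next
    case 3
    then have "\<forall>\<^sub>F z in at_right x. f z = f x + 1 * (z - x)"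
      unfolding eventually_at_right_field using PLo_outside[OF assms]
      by (intro exI[of _ "x + 1"]) auto
    then show ?thesis by blast
  qed
qed

lemma PLo_germ_left:
  assumes "f \<in> PLo"
  shows "\<exists>m. \<forall>\<^sub>F z in at_left x. f z = f x + m * (z - x)"
proof -
  consider "1 < x" | "0 < x" "x \<le> 1" | "x \<le> 0" by linarith
  then show ?thesis
  proof cases
    case 1
    then have "\<forall>\<^sub>F z in at_left x. f z = f x + 1 * (z - x)"
      unfolding eventually_at_left_field using PLo_outside[OF assms] by (intro exI[of _ 1]) auto
    then show ?thesis by blast
  next
    case 2
    obtain B where B: "piecewise_affine_on B f" using assms by (auto simp: PLo_iff)
    then obtain y where y: "0 \<le> y" "y < x" "{y<..<x} \<inter> B = {}"
      using finite_gap_left[of B 0 x] 2 unfolding piecewise_affine_on_def by blast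
    moreover have "x \<in> {0..1}" "y \<in> {0..1}" using 2 y by auto
    ultimately obtain m c where mc: "\<forall>z\<in>{y..x}. f z = m * z + c"
      using B unfolding piecewise_affine_on_def by blast
    have "\<forall>\<^sub>F z in at_left x. f z = f x + m * (z - x)"
      unfolding eventually_at_left_field using y mc
      by (intro exI[of _ y]) (auto simp: algebra_simps)
    then show ?thesis by blast
  next
    case 3
    then have "\<forall>\<^sub>F z in at_left x. f z = f x + 1 * (z - x)"
      unfolding eventually_at_left_field using PLo_outside[OF assms]
      by (intro exI[of _ "x - 1"]) auto
    then show ?thesis by blast
  qed
qed

lemma PLo_isCont:
  assumes "f \<in> PLo"
  shows "isCont f x"
proof -
  have *: "(f \<longlongrightarrow> f x) F"
    if "F \<le> at x" "\<forall>\<^sub>F z in F. f z = f x + m * (z - x)" for F m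
  proof -
    have "((\<lambda>z. f x + m * (z - x)) \<longlongrightarrow> f x + m * (x - x)) (at x)"
      by (intro tendsto_intros)
    then have "((\<lambda>z. f x + m * (z - x)) \<longlongrightarrow> f x) F"
      using that(1) by (auto intro: tendsto_mono)
    then show ?thesis using that(2) by (simp add: tendsto_cong)
  qed
  have "(f \<longlongrightarrow> f x) (at_right x)" "(f \<longlongrightarrow> f x) (at_left x)"
    using PLo_germ_right[OF assms, of x] PLo_germ_left[OF assms, of x]
    by (auto intro: * simp: at_le)
  then show ?thesis by (simp add: isCont_def filterlim_split_at)
qed

lemma PLo_continuous_on: "f \<in> PLo \<Longrightarrow> continuous_on S f"
  by (simp add: PLo_isCont continuous_at_imp_continuous_on)

section \<open>Bijectivity and closure under composition and inversion\<close>

lemma PLo_bij: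
  assumes "f \<in> PLo"
  shows "bij f"
proof (rule bijI)
  show "inj f" using PLo_strict_mono[OF assms] strict_mono_imp_inj_on by blast
  show "surj f"
  proof (rule surjI)
    fix y
    have "\<exists>x. f x = y"
    proof (cases "y \<in> {0..1}")
      case True
      then show ?thesis
        using IVT'[of f 0 y 1] PLo_outside[OF assms] PLo_continuous_on[OF assms] by force
    next
      case False
      then show ?thesis using PLo_outside[OF assms, of y] by force
    qed
    then show "f (SOME x. f x = y) = y" by (rule someI_ex)
  qed
qed

abbreviation finv :: "(real \<Rightarrow> real) \<Rightarrow> real \<Rightarrow> real" where
  "finv f \<equiv> inv_into UNIV f"

lemma PLo_inv_simps [simp]:
  assumes "f \<in> PLo"
  shows "f (finv f x) = x" "finv f (f x) = x"
  using PLo_bij[OF assms] by (simp_all add: bij_is_inj bij_is_surj surj_f_inv_f)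

lemma PLo_maps_unit:
  assumes "f \<in> PLo"
  shows "f x \<in> {0..1} \<longleftrightarrow> x \<in> {0..1}"
  using PLo_le_iff[OF assms, of 0 x] PLo_le_iff[OF assms, of x 1] PLo_outside[OF assms] by auto

lemma PLo_id: "id \<in> PLo"
proof -
  have "piecewise_affine_on {} id"
    unfolding piecewise_affine_on_def by (force intro: exI[of _ 1])
  then show ?thesis by (auto simp: PLo_iff strict_mono_on_def)
qed

text \<open>A break of \<open>g \<circ> f\<close> is a break of \<open>f\<close> or a point that
  \<open>f\<close> takes to a break of \<open>g\<close>.\<close>

lemma PLo_comp:
  assumes f: "f \<in> PLo" and g: "g \<in> PLo"
  shows "g \<circ> f \<in> PLo"
proof -
  obtain B C where B: "piecewise_affine_on B f" and C: "piecewise_affine_on C g"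
    using assms by (auto simp: PLo_iff)
  have "piecewise_affine_on (B \<union> finv f ` C) (g \<circ> f)"
    unfolding piecewise_affine_on_def
  proof (intro conjI ballI impI)
    show "finite (B \<union> finv f ` C)" using B C by (simp add: piecewise_affine_on_def)
    fix x y :: real
    assume x: "x \<in> {0..1}" and y: "y \<in> {0..1}"
      and xy: "x < y \<and> {x<..<y} \<inter> (B \<union> finv f ` C) = {}"
    then have "{x<..<y} \<inter> B = {}" by blast
    with B x y xy obtain m c where mc: "\<forall>z\<in>{x..y}. f z = m * z + c"
      unfolding piecewise_affine_on_def by blast
    have "{f x<..<f y} \<inter> C = {}"
    proof (rule ccontr)
      assume "{f x<..<f y} \<inter> C \<noteq> {}"
      then obtain w where w: "f x < w" "w < f y" "w \<in> C" by auto
      then have "x < finv f w" "finv f w < y"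
        using PLo_less_iff[OF f, of x "finv f w"] PLo_less_iff[OF f, of "finv f w" y] f by auto
      with w xy show False by auto
    qed
    moreover have "f x \<in> {0..1}" "f y \<in> {0..1}" "f x < f y"
      using x y xy PLo_maps_unit[OF f] PLo_less_iff[OF f] by blast+
    ultimately obtain m' c' where mc': "\<forall>z\<in>{f x..f y}. g z = m' * z + c'"
      using C unfolding piecewise_affine_on_def by blast
    have "(g \<circ> f) z = (m' * m) * z + (m' * c + c')" if "z \<in> {x..y}" for z
    proof -
      have "f z \<in> {f x..f y}" using that PLo_le_iff[OF f] by auto
      then have "g (f z) = m' * f z + c'" using mc' by blast
      then show ?thesis using mc that by (simp add: algebra_simps)
    qed
    then show "\<exists>m c. \<forall>z\<in>{x..y}. (g \<circ> f) z = m * z + c" by blast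
  qed
  moreover have "strict_mono_on {0..1} (g \<circ> f)"
    using PLo_less_iff[OF f] PLo_less_iff[OF g] by (simp add: strict_mono_on_def)
  ultimately show ?thesis
    using PLo_outside[OF f] PLo_outside[OF g] unfolding PLo_iff by auto
qed

lemma PLo_inv:
  assumes f: "f \<in> PLo"
  shows "finv f \<in> PLo"
proof -
  obtain B where B: "piecewise_affine_on B f"
    using assms by (auto simp: PLo_iff)
  have less: "finv f x < finv f y \<longleftrightarrow> x < y" for x y
    using PLo_less_iff[OF f, of "finv f x" "finv f y"] f by simp
  have "piecewise_affine_on (f ` B) (finv f)"
    unfolding piecewise_affine_on_def
  proof (intro conjI ballI impI)
    show "finite (f ` B)" using B by (simp add: piecewise_affine_on_def)
    fix x y :: real
    assume x: "x \<in> {0..1}" and y: "y \<in> {0..1}"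
      and xy: "x < y \<and> {x<..<y} \<inter> f ` B = {}"
    have "{finv f x<..<finv f y} \<inter> B = {}"
    proof (rule ccontr)
      assume "{finv f x<..<finv f y} \<inter> B \<noteq> {}"
      then obtain w where w: "finv f x < w" "w < finv f y" "w \<in> B" by auto
      then have "x < f w" "f w < y"
        using less[of x "f w"] less[of "f w" y] f by auto
      with w xy show False by auto
    qed
    moreover have "finv f x \<in> {0..1}" "finv f y \<in> {0..1}"
      using x y PLo_maps_unit[OF f, of "finv f x"] PLo_maps_unit[OF f, of "finv f y"] f by auto
    moreover have ixy: "finv f x < finv f y" using less xy by blast
    ultimately obtain m c where mc: "\<forall>z\<in>{finv f x..finv f y}. f z = m * z + c"
      using B unfolding piecewise_affine_on_def by blast
    have inv_eq: "z = m * finv f z + c" if "z \<in> {x..y}" for z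
    proof -
      have "finv f z \<in> {finv f x..finv f y}" using that less[of z x] less[of y z] by auto
      then have "f (finv f z) = m * finv f z + c" using mc by blast
      then show ?thesis using f by simp
    qed
    have "m \<noteq> 0" using inv_eq[of x] inv_eq[of y] xy by auto
    then have "finv f z = (1 / m) * z + (- c / m)" if "z \<in> {x..y}" for z
      using inv_eq[OF that] by (simp add: field_simps)
    then show "\<exists>m c. \<forall>z\<in>{x..y}. finv f z = m * z + c" by blast
  qed
  moreover have "strict_mono_on {0..1} (finv f)" using less by (simp add: strict_mono_on_def)
  moreover have "finv f x = x" if "f x = x" for x
    using that PLo_inv_simps(2)[OF f, of x] by simp
  ultimately show ?thesis using PLo_outside[OF f] unfolding PLo_iff by auto
qed

lemma PLo_inv_comp:
  assumes "f \<in> PLo"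
  shows "finv f \<circ> f = id" "f \<circ> finv f = id"
  using assms by (auto simp: fun_eq_iff)

section \<open>The ambient group, its subgroups and commutators\<close>

lemma PLo_group_simps [simp]:
  "carrier PLo_group = PLo" "\<one>\<^bsub>PLo_group\<^esub> = id" "f \<otimes>\<^bsub>PLo_group\<^esub> g = g \<circ> f"
  by (simp_all add: PLo_group_def)

interpretation PLo: group PLo_group
proof (rule groupI)
  fix f
  assume "f \<in> carrier PLo_group"
  then show "\<exists>g\<in>carrier PLo_group. g \<otimes>\<^bsub>PLo_group\<^esub> f = \<one>\<^bsub>PLo_group\<^esub>"
    using PLo_inv PLo_inv_comp by auto
qed (auto simp: PLo_comp PLo_id comp_assoc)

lemma PLo_m_inv [simp]: "f \<in> PLo \<Longrightarrow> inv\<^bsub>PLo_group\<^esub> f = finv f"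
  by (rule PLo.inv_equality) (auto simp: PLo_inv_comp PLo_inv)

abbreviation PLo_derived :: "(real \<Rightarrow> real) set \<Rightarrow> (real \<Rightarrow> real) set" where
  "PLo_derived \<equiv> derived PLo_group"

abbreviation PLo_subgroup :: "(real \<Rightarrow> real) set \<Rightarrow> bool" where
  "PLo_subgroup G \<equiv> subgroup G PLo_group"

lemma subgroupD:
  assumes "PLo_subgroup G"
  shows "id \<in> G"
    and "f \<in> G \<Longrightarrow> f \<in> PLo"
    and "f \<in> G \<Longrightarrow> g \<in> G \<Longrightarrow> g \<circ> f \<in> G"
    and "f \<in> G \<Longrightarrow> finv f \<in> G"
proof -
  interpret subgroup G PLo_group by fact
  show "id \<in> G" using one_closed by simp
  show PL: "f \<in> PLo" if "f \<in> G" for f using that subset by auto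
  show "g \<circ> f \<in> G" if "f \<in> G" "g \<in> G" using m_closed[of f g] that by simp
  show "finv f \<in> G" if "f \<in> G" using m_inv_closed[of f] that PL by simp
qed

lemma subgroup_PLoI:
  assumes "G \<subseteq> PLo" "id \<in> G"
    and "\<And>f g. f \<in> G \<Longrightarrow> g \<in> G \<Longrightarrow> g \<circ> f \<in> G"
    and "\<And>f. f \<in> G \<Longrightarrow> finv f \<in> G"
  shows "PLo_subgroup G"
  by (rule PLo.subgroupI) (use assms in \<open>auto simp: subsetD\<close>)

text \<open>Under the right action the commutator of \<open>f\<close> and \<open>g\<close>, in this
  order, becomes a composition read from right to left.\<close>

lemma commutator_in_derived:
  assumes "PLo_subgroup G" "f \<in> G" "g \<in> G"
  shows "finv g \<circ> (finv f \<circ> (g \<circ> f)) \<in> PLo_derived G"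
proof -
  have "f \<otimes>\<^bsub>PLo_group\<^esub> g \<otimes>\<^bsub>PLo_group\<^esub> inv\<^bsub>PLo_group\<^esub> f \<otimes>\<^bsub>PLo_group\<^esub> inv\<^bsub>PLo_group\<^esub> g
    \<in> PLo_derived G"
    unfolding derived_def using assms by (blast intro: generate.incl)
  then show ?thesis using assms subgroupD(2)[OF assms(1)] by simp
qed

lemma derived_subsetI:
  assumes "PLo_subgroup G" "PLo_subgroup N"
    and "\<And>f g. f \<in> G \<Longrightarrow> g \<in> G \<Longrightarrow> finv g \<circ> (finv f \<circ> (g \<circ> f)) \<in> N"
  shows "PLo_derived G \<subseteq> N"
  unfolding derived_def
proof (rule PLo.generate_subgroup_incl)
  show "derived_set PLo_group G \<subseteq> N"
    using assms(3) subgroupD(2)[OF assms(1)] by auto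
qed fact

lemma derived_subgroup:
  assumes "PLo_subgroup G"
  shows "PLo_subgroup (PLo_derived G)" "PLo_derived G \<subseteq> G"
  using PLo.derived_is_subgroup[OF subgroup.subset[OF assms]]
    PLo.derived_incl[OF order_refl assms] by auto

subsection \<open>Orbitals as open intervals\<close>

text \<open>Recording an orbital by its endpoints reduces later arguments to inequalities;
  \<open>orbitals_iff\<close> links this form to connected components.\<close>

definition orbital :: "(real \<Rightarrow> real) \<Rightarrow> real \<Rightarrow> real \<Rightarrow> bool" where
  "orbital f a b \<longleftrightarrow> a < b \<and> f a = a \<and> f b = b \<and> (\<forall>x. a < x \<and> x < b \<longrightarrow> f x \<noteq> x)"

lemma closed_fixed_points:
  fixes f :: "real \<Rightarrow> real"
  assumes "continuous_on UNIV f"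
  shows "closed {x. f x = x}"
  by (intro closed_Collect_eq assms continuous_on_id)

text \<open>The endpoints are the supremum of \<open>S\<close> below \<open>x\<close> and the
  infimum of \<open>S\<close> above \<open>x\<close>. It serves for the fixed points of one element
  and for the common fixed points of two.\<close>

lemma closed_gap:
  fixes S :: "real set"
  assumes "closed S" "x \<notin> S" "l \<in> S" "l < x" "r \<in> S" "x < r"
  obtains a b where "a \<in> S" "b \<in> S" "l \<le> a" "a < x" "x < b" "b \<le> r" "{a<..<b} \<inter> S = {}"
proof -
  let ?L = "S \<inter> {..x}" and ?R = "S \<inter> {x..}"
  have L: "closed ?L" "?L \<noteq> {}" "bdd_above ?L" and R: "closed ?R" "?R \<noteq> {}" "bdd_below ?R"
    using assms by (auto simp: closed_Int)
  have S: "Sup ?L \<in> S" "Sup ?L \<le> x" "Inf ?R \<in> S" "x \<le> Inf ?R"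
    using closed_contains_Sup[OF L(2,3,1)] closed_contains_Inf[OF R(2,3,1)] by auto
  show thesis
  proof
    show "Sup ?L \<in> S" "Inf ?R \<in> S" by fact+
    show "Sup ?L < x" "x < Inf ?R" using S assms(2) by (auto simp: order.strict_iff_order)
    show "l \<le> Sup ?L" using assms L by (intro cSup_upper) auto
    show "Inf ?R \<le> r" using assms R by (intro cInf_lower) auto
    show "{Sup ?L<..<Inf ?R} \<inter> S = {}"
    proof (rule ccontr)
      assume "{Sup ?L<..<Inf ?R} \<inter> S \<noteq> {}"
      then obtain y where y: "Sup ?L < y" "y < Inf ?R" "y \<in> S" by auto
      have "y \<le> Sup ?L \<or> Inf ?R \<le> y"
        using y(3) L(3) R(3) by (cases "y \<le> x") (auto intro: cSup_upper cInf_lower)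
      with y show False by linarith
    qed
  qed
qed

lemma orbital_exists:
  assumes "f \<in> PLo" "f x \<noteq> x"
  obtains a b where "orbital f a b" "a < x" "x < b"
proof -
  have x: "0 < x" "x < 1"
    using PLo_outside[OF assms(1), of x] assms(2) by (meson not_le)+
  let ?S = "{x. f x = x}"
  have S: "closed ?S" "x \<notin> ?S" "0 \<in> ?S" "1 \<in> ?S"
    using closed_fixed_points[OF PLo_continuous_on[OF assms(1)]] assms(2)
    by (simp_all add: PLo_outside[OF assms(1)])
  obtain a b where ab: "a \<in> ?S" "b \<in> ?S" "0 \<le> a" "a < x" "x < b" "b \<le> 1"
      "{a<..<b} \<inter> ?S = {}"
    by (rule closed_gap[OF S(1,2,3) x(1) S(4) x(2)])
  show thesis
  proof
    have "a < b" using ab(4,5) by (rule less_trans)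
    moreover have "f y \<noteq> y" if "a < y" "y < b" for y
      using ab(7) that by auto
    ultimately show "orbital f a b" using ab(1,2) by (simp add: orbital_def)
  qed fact+
qed

text \<open>A connected set contains the segment between any two of its points, so the component of
  \<open>x\<close> cannot reach past the fixed points \<open>a\<close> and \<open>b\<close>.\<close>

lemma orbital_component:
  assumes "orbital f a b" "a < x" "x < b"
  shows "connected_component_set (supp f) x = {a<..<b}"
proof (rule subset_antisym)
  have "{a<..<b} \<subseteq> supp f" using assms by (auto simp: orbital_def supp_def)
  then show "{a<..<b} \<subseteq> connected_component_set (supp f) x"
    using assms by (intro connected_component_maximal) auto
  let ?C = "connected_component_set (supp f) x"
  have x: "x \<in> ?C"
    using assms by (simp add: orbital_def supp_def)
  have C: "connected ?C" "?C \<subseteq> supp f"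
    by (simp_all add: connected_component_subset)
  have ab: "a \<notin> ?C" "b \<notin> ?C" using assms C(2) by (auto simp: orbital_def supp_def)
  show "?C \<subseteq> {a<..<b}"
  proof
    fix y
    assume "y \<in> ?C"
    then have "{y..x} \<subseteq> ?C" "{x..y} \<subseteq> ?C"
      using connected_contains_Icc[OF C(1)] x by blast+
    then have "a \<notin> {y..x}" "b \<notin> {x..y}" using ab by blast+
    then show "y \<in> {a<..<b}" using assms by auto
  qed
qed

lemma orbitals_iff:
  assumes "f \<in> PLo"
  shows "A \<in> orbitals f \<longleftrightarrow> (\<exists>a b. orbital f a b \<and> A = {a<..<b})"
proof
  assume "A \<in> orbitals f"
  then obtain x where x: "f x \<noteq> x" "A = connected_component_set (supp f) x"
    unfolding orbitals_def supp_def by auto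
  with orbital_exists[OF assms x(1)] orbital_component
  show "\<exists>a b. orbital f a b \<and> A = {a<..<b}" by metis
next
  assume "\<exists>a b. orbital f a b \<and> A = {a<..<b}"
  then obtain a b where *: "orbital f a b" "A = {a<..<b}" by blast
  then obtain x where x: "a < x" "x < b" by (meson dense orbital_def)
  then have "x \<in> supp f" using * by (simp add: orbital_def supp_def)
  then show "A \<in> orbitals f"
    using orbital_component[OF *(1) x] * unfolding orbitals_def by auto
qed

lemma orbital_less_right_end:
  assumes "f \<in> PLo" "orbital f a b"
  shows "f x < b \<longleftrightarrow> x < b"
  using PLo_less_iff[OF assms(1), of x b] assms(2) by (simp add: orbital_def)

subsection \<open>Orbits and common fixed points\<close>

text \<open>Otherwise the infimum \<open>u\<close> of the orbit of \<open>s\<close> lies in (a, b),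
  and some element moves it to the left. By continuity that element also takes orbit points close to
  \<open>u\<close> below \<open>u\<close>.\<close>

lemma orbit_unbounded_below:
  assumes K: "PLo_subgroup K"
    and moves: "\<And>u. a < u \<Longrightarrow> u < b \<Longrightarrow> \<exists>k\<in>K. k u \<noteq> u"
    and s: "a < s" "s < b" and t: "a < t"
  shows "\<exists>k\<in>K. k s < t"
proof (rule ccontr)
  assume "\<not> ?thesis"
  then have lower: "t \<le> k s" if "k \<in> K" for k using that by force
  define u where "u = (INF k\<in>K. k s)"
  have bdd: "bdd_below ((\<lambda>k. k s) ` K)" using lower by (intro bdd_belowI[of _ t]) auto
  have "t \<le> u" unfolding u_def using lower subgroupD(1)[OF K] by (intro cINF_greatest) auto
  moreover have "u \<le> s"
    unfolding u_def using cINF_lower[OF bdd subgroupD(1)[OF K]] by simp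
  ultimately obtain k0 where k0: "k0 \<in> K" "k0 u \<noteq> u" using moves[of u] s t by auto
  \<comment> \<open>Either \<open>k0\<close> or its inverse moves \<open>u\<close> to the
    left.\<close>
  obtain k where k: "k \<in> K" "k u < u"
  proof (cases "k0 u < u")
    case False
    then have "finv k0 u < u"
      using PLo_less_iff[of k0 "finv k0 u" u] subgroupD(2)[OF K] k0 by simp
    then show thesis using that subgroupD(4)[OF K k0(1)] by blast
  qed (use that k0 in blast)
  then have "\<forall>\<^sub>F z in at_right u. k z < u"
    using PLo_isCont[of k u] subgroupD(2)[OF K k(1)]
    by (intro order_tendstoD(2)[of k "k u"]) (auto simp: isCont_def filterlim_at_split)
  then obtain e where e: "u < e" "\<And>z. u < z \<Longrightarrow> z < e \<Longrightarrow> k z < u"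
    unfolding eventually_at_right_field by blast
  obtain l where l: "l \<in> K" "l s < e"
    using e(1) subgroupD(1)[OF K] bdd unfolding u_def by (subst (asm) cINF_less_iff) auto
  \<comment> \<open>The right neighbourhood omits \<open>u\<close> itself, so an attained infimum is
    a separate case.\<close>
  have "u \<le> l s" unfolding u_def using cINF_lower[OF bdd l(1)] .
  then have "k (l s) < u" using e(2) l(2) k(2) by (cases "l s = u") auto
  moreover have "u \<le> (k \<circ> l) s"
    unfolding u_def using cINF_lower[OF bdd subgroupD(3)[OF K l(1) k(1)]] .
  ultimately show False by simp
qed

text \<open>The inverse of an element taking \<open>t\<close> below \<open>s\<close> takes
  \<open>s\<close> above \<open>t\<close>.\<close>

lemma orbit_unbounded_above:
  assumes K: "PLo_subgroup K"
    and moves: "\<And>u. a < u \<Longrightarrow> u < b \<Longrightarrow> \<exists>k\<in>K. k u \<noteq> u"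
    and s: "a < s" and t: "a < t" "t < b"
  shows "\<exists>k\<in>K. t < k s"
proof -
  obtain k where k: "k \<in> K" "k t < s" using orbit_unbounded_below[OF K moves t s] by blast
  then have "t < finv k s"
    using PLo_less_iff[of k t "finv k s"] subgroupD(2)[OF K] by simp
  then show ?thesis using subgroupD(4)[OF K k(1)] by blast
qed

text \<open>Elements are increasing, so fixing both endpoints preserves the interval. With
  \<open>a = b\<close> this is the stabilizer of a point.\<close>

definition stabilizer :: "(real \<Rightarrow> real) set \<Rightarrow> real \<Rightarrow> real \<Rightarrow> (real \<Rightarrow> real) set" where
  "stabilizer G a b = {k \<in> G. k a = a \<and> k b = b}"

lemma finv_fixed:
  assumes "f \<in> PLo" "f x = x"
  shows "finv f x = x"
  using PLo_inv_simps(2)[OF assms(1), of x] assms(2) by simp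

lemma stabilizer_subgroup:
  assumes "PLo_subgroup G"
  shows "PLo_subgroup (stabilizer G a b)"
  using subgroupD[OF assms] unfolding stabilizer_def
  by (intro subgroup_PLoI) (auto simp: finv_fixed)

text \<open>The stabilizer of the endpoints contains \<open>h\<close>, which already moves every
  point between them, so orbits come arbitrarily close to \<open>c\<close>.\<close>

lemma orbital_push_left:
  assumes G: "PLo_subgroup G" and h: "h \<in> G" "orbital h c d"
    and s: "c < s" "s < d" and t: "c < t"
  shows "\<exists>k\<in>G. k c = c \<and> k d = d \<and> k s < t"
proof -
  have "\<exists>k\<in>stabilizer G c d. k s < t"
    by (rule orbit_unbounded_below[OF stabilizer_subgroup[OF G] _ s t])
      (use h in \<open>auto simp: stabilizer_def orbital_def\<close>)
  then show ?thesis by (auto simp: stabilizer_def)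
qed

lemma orbital_push_right:
  assumes G: "PLo_subgroup G" and h: "h \<in> G" "orbital h c d"
    and s: "c < s" and t: "c < t" "t < d"
  shows "\<exists>k\<in>G. k c = c \<and> k d = d \<and> t < k s"
proof -
  have "\<exists>k\<in>stabilizer G c d. t < k s"
    by (rule orbit_unbounded_above[OF stabilizer_subgroup[OF G] _ s t])
      (use h in \<open>auto simp: stabilizer_def orbital_def\<close>)
  then show ?thesis by (auto simp: stabilizer_def)
qed

subsection \<open>Germs of commutators\<close>

lemma PLo_germ:
  assumes "f \<in> PLo" "F = at_right x \<or> F = at_left x"
  shows "\<exists>m. \<forall>\<^sub>F z in F. f z = f x + m * (z - x)"
  using assms PLo_germ_left PLo_germ_right by blast

text \<open>An increasing map fixing \<open>x\<close> preserves each side of \<open>x\<close>, so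
  one-sided germs at \<open>x\<close> can be composed.\<close>

lemma PLo_filterlim_germ:
  assumes "f \<in> PLo" "f x = x" "F = at_right x \<or> F = at_left x"
  shows "filterlim f F F"
proof -
  have "isCont f x" by (rule PLo_isCont) fact
  then have lim: "(f \<longlongrightarrow> x) (at_right x)" "(f \<longlongrightarrow> x) (at_left x)"
    using assms(2) by (auto simp: isCont_def filterlim_at_split)
  have "\<forall>\<^sub>F z in at_right x. x < f z"
    using PLo_less_iff[OF assms(1), of x] assms(2)
    unfolding eventually_at_right_field by (intro exI[of _ "x + 1"]) simp
  moreover have "\<forall>\<^sub>F z in at_left x. f z < x"
    using PLo_less_iff[OF assms(1), of _ x] assms(2)
    unfolding eventually_at_left_field by (intro exI[of _ "x - 1"]) simp
  ultimately show ?thesis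
    using assms(3) lim
    by (auto simp: filterlim_at elim: eventually_mono)
qed

text \<open>In the coordinate \<open>z - x\<close> both germs are multiplications by a
  slope.\<close>

lemma germs_commute:
  assumes "f \<in> PLo" "g \<in> PLo" "f x = x" "g x = x" and F: "F = at_right x \<or> F = at_left x"
  shows "\<forall>\<^sub>F z in F. g (f z) = f (g z)"
proof -
  obtain m m' where m: "\<forall>\<^sub>F z in F. f z = x + m * (z - x)"
    and m': "\<forall>\<^sub>F z in F. g z = x + m' * (z - x)"
    using PLo_germ[OF assms(1) F] PLo_germ[OF assms(2) F] assms(3,4) by auto
  have "\<forall>\<^sub>F z in F. f (g z) = x + m * (g z - x)"
    using m PLo_filterlim_germ[OF assms(2,4) F] by (rule eventually_compose_filterlim)
  moreover have "\<forall>\<^sub>F z in F. g (f z) = x + m' * (f z - x)"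
    using m' PLo_filterlim_germ[OF assms(1,3) F] by (rule eventually_compose_filterlim)
  ultimately show ?thesis using m m' by eventually_elim simp
qed

text \<open>The elements with trivial germ form a subgroup, and it contains every commutator by
  \<open>germs_commute\<close>.\<close>

lemma derived_trivial_germ:
  assumes G: "PLo_subgroup G" and fixed: "\<forall>g\<in>G. g x = x"
    and F: "F = at_right x \<or> F = at_left x" and f: "f \<in> PLo_derived G"
  shows "\<forall>\<^sub>F z in F. f z = z"
proof -
  let ?N = "{g \<in> G. \<forall>\<^sub>F z in F. g z = z}"
  have N: "PLo_subgroup ?N"
  proof (rule subgroup_PLoI)
    fix g h
    assume "g \<in> ?N" "h \<in> ?N"
    then have "h \<circ> g \<in> G" and ev: "\<forall>\<^sub>F z in F. g z = z" "\<forall>\<^sub>F z in F. h z = z"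
      using subgroupD(3)[OF G] by auto
    moreover have "\<forall>\<^sub>F z in F. (h \<circ> g) z = z"
      using ev by eventually_elim simp
    ultimately show "h \<circ> g \<in> ?N" by blast
  next
    fix g
    assume "g \<in> ?N"
    then have g: "g \<in> G" and ev: "\<forall>\<^sub>F z in F. g z = z" by auto
    have "\<forall>\<^sub>F z in F. finv g z = z"
      using ev by eventually_elim (simp add: finv_fixed subgroupD(2)[OF G g])
    then show "finv g \<in> ?N" using subgroupD(4)[OF G g] by blast
  next
    show "?N \<subseteq> PLo" "id \<in> ?N" using subgroupD(1,2)[OF G] by auto
  qed
  have "finv g \<circ> (finv f \<circ> (g \<circ> f)) \<in> ?N" if "f \<in> G" "g \<in> G" for f g
  proof -
    have PL: "f \<in> PLo" "g \<in> PLo" using that subgroupD(2)[OF G] by auto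
    have "\<forall>\<^sub>F z in F. g (f z) = f (g z)"
      using germs_commute[OF PL] fixed F that by blast
    then have "\<forall>\<^sub>F z in F. (finv g \<circ> (finv f \<circ> (g \<circ> f))) z = z"
      by (rule eventually_mono) (simp add: PL)
    moreover have "finv g \<circ> (finv f \<circ> (g \<circ> f)) \<in> G"
      using that by (intro subgroupD(3,4)[OF G])
    ultimately show ?thesis by blast
  qed
  then have "PLo_derived G \<subseteq> ?N" by (rule derived_subsetI[OF G N])
  with f have "f \<in> ?N" by (rule subsetD[rotated])
  then show ?thesis by simp
qed

section \<open>Iterated derived subgroups and the points they move\<close>

lemma derived_power_subgroup:
  assumes "PLo_subgroup G"
  shows "PLo_subgroup ((PLo_derived ^^ n) G)" "(PLo_derived ^^ n) G \<subseteq> G"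
proof -
  show *: "PLo_subgroup ((PLo_derived ^^ n) G)" for n
    by (rule PLo.exp_of_derived_is_subgroup) fact
  show "(PLo_derived ^^ n) G \<subseteq> G"
    using derived_subgroup(2)[OF *] by (induction n) auto
qed

lemma derived_power_mono:
  "H \<subseteq> G \<Longrightarrow> (PLo_derived ^^ n) H \<subseteq> (PLo_derived ^^ n) G"
  by (rule PLo.mono_exp_of_derived)

text \<open>For a subgroup these are the common fixed points of its derived subgroup, described
  without commutators.\<close>

definition commuting_points :: "(real \<Rightarrow> real) set \<Rightarrow> real set" where
  "commuting_points G = {x. \<forall>f\<in>G. \<forall>g\<in>G. f (g x) = g (f x)}"

lemma derived_moves_point:
  assumes "PLo_subgroup G" "x \<notin> commuting_points G"
  shows "\<exists>k\<in>PLo_derived G. k x \<noteq> x"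
proof -
  obtain f g where fg: "f \<in> G" "g \<in> G" "f (g x) \<noteq> g (f x)"
    using assms(2) by (auto simp: commuting_points_def)
  then have PL: "f \<in> PLo" "g \<in> PLo" using subgroupD(2)[OF assms(1)] by auto
  have "finv g (finv f (g (f x))) \<noteq> x"
  proof
    assume *: "finv g (finv f (g (f x))) = x"
    have "f (g (finv g (finv f (g (f x))))) = g (f x)" using PL by simp
    with * fg(3) show False by simp
  qed
  then show ?thesis using bexI[OF _ commutator_in_derived[OF assms(1) fg(1,2)]] by simp
qed

text \<open>The product \<open>g \<circ> k\<close> commutes with \<open>f\<close> at
  \<open>x\<close> as well, and so does \<open>k\<close>.\<close>

lemma commuting_points_invariant:
  assumes "PLo_subgroup G" "x \<in> commuting_points G" "k \<in> G"
  shows "k x \<in> commuting_points G"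
  unfolding commuting_points_def
proof (intro CollectI ballI)
  fix f g
  assume fg: "f \<in> G" "g \<in> G"
  have *: "u (v x) = v (u x)" if "u \<in> G" "v \<in> G" for u v
    using assms(2) that by (auto simp: commuting_points_def)
  have "f ((g \<circ> k) x) = (g \<circ> k) (f x)"
    using * fg assms(3) subgroupD(3)[OF assms(1)] by blast
  also have "\<dots> = g (f (k x))" using *[OF fg(1) assms(3)] by simp
  finally show "f (g (k x)) = g (f (k x))" by simp
qed

lemma closed_commuting_points:
  assumes "PLo_subgroup G"
  shows "closed (commuting_points G)"
proof -
  have "closed {x. f (g x) = g (f x)}" if "f \<in> G" "g \<in> G" for f g
  proof -
    have "continuous_on UNIV f" "continuous_on UNIV g"
      using that subgroupD(2)[OF assms] PLo_continuous_on by auto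
    then show ?thesis
      by (intro closed_Collect_eq)
        (auto intro: continuous_on_compose2[of UNIV])
  qed
  moreover have "commuting_points G = (\<Inter>f\<in>G. \<Inter>g\<in>G. {x. f (g x) = g (f x)})"
    by (auto simp: commuting_points_def)
  ultimately show ?thesis by auto
qed

definition moves_all :: "(real \<Rightarrow> real) set \<Rightarrow> real \<Rightarrow> real \<Rightarrow> bool" where
  "moves_all K a b \<longleftrightarrow> (\<forall>u. a < u \<and> u < b \<longrightarrow> (\<exists>k\<in>K. k u \<noteq> u))"

text \<open>An element moving a commuting point moves its whole orbit, but the orbit accumulates at
  the endpoint a, near which the element is trivial.\<close>

lemma derived_moves_all:
  assumes K: "PLo_subgroup K" and m: "moves_all K a b"
    and fixed: "\<forall>k\<in>K. k a = a"
    and germ: "\<forall>k\<in>K. \<forall>\<^sub>F z in at_right a. k z = z"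
  shows "moves_all (PLo_derived K) a b"
  unfolding moves_all_def
proof (intro allI impI, rule derived_moves_point[OF K], rule notI)
  fix u
  assume u: "a < u \<and> u < b" and comm: "u \<in> commuting_points K"
  then obtain k where k: "k \<in> K" "k u \<noteq> u" using m by (auto simp: moves_all_def)
  obtain e where e: "a < e" "\<And>z. a < z \<Longrightarrow> z < e \<Longrightarrow> k z = z"
    using bspec[OF germ k(1)] unfolding eventually_at_right_field by blast
  obtain l where l: "l \<in> K" "l u < e"
    using orbit_unbounded_below[OF K _ _ _ e(1)] m u unfolding moves_all_def by blast
  have PL: "l \<in> PLo" using subgroupD(2)[OF K l(1)] .
  have "a < l u" using PLo_less_iff[OF PL, of a u] bspec[OF fixed l(1)] u by simp
  then have "k (l u) = l u" using e(2) l(2) by blast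
  moreover have "k (l u) = l (k u)" using comm k(1) l(1) by (simp add: commuting_points_def)
  ultimately show False using PLo_eq_iff[OF PL] k(2) by simp
qed

text \<open>The fixed endpoint and the trivial germs pass to subgroups, so
  \<open>derived_moves_all\<close> can be iterated.\<close>

lemma derived_power_moves_all:
  assumes K: "PLo_subgroup K" and m: "moves_all K a b"
    and fixed: "\<forall>k\<in>K. k a = a"
    and germ: "\<forall>k\<in>K. \<forall>\<^sub>F z in at_right a. k z = z"
  shows "moves_all ((PLo_derived ^^ n) K) a b"
proof (induction n)
  case (Suc n)
  have "\<forall>k\<in>(PLo_derived ^^ n) K. k a = a"
    "\<forall>k\<in>(PLo_derived ^^ n) K. \<forall>\<^sub>F z in at_right a. k z = z"
    using fixed germ derived_power_subgroup(2)[OF K, of n] by (meson subsetD)+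
  then have "moves_all (PLo_derived ((PLo_derived ^^ n) K)) a b"
    by (rule derived_moves_all[OF derived_power_subgroup(1)[OF K] Suc])
  then show ?case by simp
qed (use m in simp)

subsection \<open>Crossing orbitals\<close>

text \<open>In the absence of crossings, two orbitals of elements of \<open>G\<close> are disjoint
  or nested.\<close>

definition crossing :: "(real \<Rightarrow> real) set \<Rightarrow> bool" where
  "crossing G \<longleftrightarrow> (\<exists>g\<in>G. \<exists>h\<in>G. \<exists>a b c d.
     orbital g a b \<and> orbital h c d \<and> a < c \<and> c < b \<and> b < d)"

lemma crossingI:
  "g \<in> G \<Longrightarrow> h \<in> G \<Longrightarrow> orbital g a b \<Longrightarrow> orbital h c d \<Longrightarrow> a < c \<Longrightarrow> c < b \<Longrightarrow> b < d \<Longrightarrow>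
    crossing G"
  unfolding crossing_def by blast

text \<open>If the largest commuting point up to b were b itself, then g would fix the orbit of b,
  which meets (a, b). Otherwise both g and h fix it.\<close>

lemma crossing_derived_moves_all:
  assumes H: "PLo_subgroup H" and fixed: "\<forall>k\<in>H. k x = x"
    and g: "g \<in> H" "orbital g a b" and h: "h \<in> H" "orbital h c d"
    and abcd: "a < c" "c < b" "b < d" and xy: "x \<le> a" "d \<le> y"
    and gh: "\<And>u. x < u \<Longrightarrow> u < y \<Longrightarrow> g u \<noteq> u \<or> h u \<noteq> u"
  shows "moves_all (PLo_derived H) x y"
  unfolding moves_all_def
proof (intro allI impI, rule derived_moves_point[OF H], rule notI)
  fix u
  assume u: "x < u \<and> u < y" and comm: "u \<in> commuting_points H"
  have PL: "k \<in> PLo" if "k \<in> H" for k using subgroupD(2)[OF H that] .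
  have m: "\<exists>k\<in>H. k v \<noteq> v" if "x < v" "v < y" for v using gh[OF that] g(1) h(1) by blast
  let ?S = "commuting_points H \<inter> {..b}"
  have b: "x < b" "b < y" using abcd xy by auto
  \<comment> \<open>The commuting points are invariant, so moving \<open>u\<close> below
    \<open>b\<close> makes \<open>?S\<close> nonempty.\<close>
  obtain l where l: "l \<in> H" "l u < b"
    using orbit_unbounded_below[OF H, of x y u b] m b u by blast
  have "x < l u" using PLo_less_iff[OF PL[OF l(1)], of x u] bspec[OF fixed l(1)] u by simp
  define s where "s = Sup ?S"
  have S: "l u \<in> ?S" "bdd_above ?S" "closed ?S"
    using commuting_points_invariant[OF H comm l(1)] l closed_commuting_points[OF H] by auto
  have s: "s \<in> commuting_points H" "s \<le> b" "l u \<le> s"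
    using closed_contains_Sup[OF _ S(2,3)] S(1) cSup_upper[OF S(1,2)] unfolding s_def by auto
  have below_s: "v \<le> s" if "v \<in> commuting_points H" "v \<le> b" for v
    unfolding s_def using that S(2) by (intro cSup_upper) auto
  \<comment> \<open>Both images of \<open>s\<close> are commuting points not above \<open>b\<close>,
    hence at most the largest one, \<open>s\<close>.\<close>
  have fix_s: "k s = s" if k: "k \<in> H" "k s \<le> b" "finv k s \<le> b" for k
  proof -
    have "k s \<le> s"
      using below_s commuting_points_invariant[OF H s(1)] k by blast
    moreover have "finv k s \<le> s"
      using below_s commuting_points_invariant[OF H s(1)] k subgroupD(4)[OF H] by blast
    then have "s \<le> k s" using PLo_le_iff[OF PL[OF k(1)], of "finv k s" s] PL[OF k(1)] by simp
    ultimately show ?thesis by simp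
  qed
  \<comment> \<open>A fixed point \<open>e\<close> of \<open>k\<close> between \<open>s\<close> and
    \<open>b\<close> keeps the images of \<open>s\<close> under \<open>k\<close> and its inverse
    below \<open>b\<close>.\<close>
  have fix_s': "k s = s" if k: "k \<in> H" "k e = e" "s \<le> e" "e \<le> b" for k e
  proof (rule fix_s[OF k(1)])
    have "k s \<le> e" "finv k s \<le> e"
      using PLo_le_iff[OF PL[OF k(1)], of s e] PLo_le_iff[OF PLo_inv[OF PL[OF k(1)]], of s e]
        finv_fixed[OF PL[OF k(1)] k(2)] k(2,3) by auto
    then show "k s \<le> b" "finv k s \<le> b" using k(4) by linarith+
  qed
  have gs: "g s = s"
    using fix_s'[OF g(1), of b] g s(2) by (auto simp: orbital_def)
  show False
  proof (cases "s = b")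
    case True
    obtain k where k: "k \<in> H" "k c = c" "k b < b"
      using orbital_push_left[OF H h abcd(2,3), of b] abcd by auto
    have "a < k b" using PLo_less_iff[OF PL[OF k(1)], of c b] k abcd by linarith
    then have "g (k b) \<noteq> k b" using k g by (auto simp: orbital_def)
    moreover have "g (k b) = k (g b)"
      using s(1) True g(1) k(1) by (simp add: commuting_points_def)
    ultimately show False using g by (simp add: orbital_def)
  next
    case False
    \<comment> \<open>All points of (a, b) are moved by \<open>g\<close>. Hence \<open>s\<close>
      lies below \<open>c\<close>, a fixed point of \<open>h\<close> that is less than
      \<open>b\<close>.\<close>
    then have "s \<le> a" using gs s(2) g(2) unfolding orbital_def by force
    then have "h s = s"
      using fix_s'[OF h(1), of c] h abcd by (auto simp: orbital_def)
    with gs gh[of s] s \<open>x < l u\<close> b show False by auto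
  qed
qed

text \<open>Inside the interval each single element moves only points of a compact part, although
  \<open>K\<close> as a whole has no common fixed point there.\<close>

definition compactly_moving :: "(real \<Rightarrow> real) set \<Rightarrow> real \<Rightarrow> real \<Rightarrow> bool" where
  "compactly_moving K x y \<longleftrightarrow> PLo_subgroup K \<and> x < y \<and> moves_all K x y \<and>
     (\<forall>k\<in>K. k x = x \<and> k y = y \<and>
        (\<forall>\<^sub>F z in at_right x. k z = z) \<and> (\<forall>\<^sub>F z in at_left y. k z = z))"

lemma compactly_movingD:
  assumes "compactly_moving K x y"
  shows "PLo_subgroup K" "x < y" "moves_all K x y"
    and "\<forall>k\<in>K. k x = x" "\<forall>k\<in>K. \<forall>\<^sub>F z in at_right x. k z = z"
    and "\<forall>k\<in>K. \<forall>\<^sub>F z in at_left y. k z = z"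
  using assms unfolding compactly_moving_def by fast+

text \<open>The interval is the component of the union of the supports of g and h that contains both
  crossing orbitals.\<close>

lemma crossing_obtains_subgroup:
  assumes G: "PLo_subgroup G" and "crossing G"
  obtains K x y where "K \<subseteq> G" "compactly_moving K x y"
proof -
  obtain g h a b c d where g: "g \<in> G" "orbital g a b" and h: "h \<in> G" "orbital h c d"
    and abcd: "a < c" "c < b" "b < d"
    using assms(2) unfolding crossing_def by blast
  have PL: "g \<in> PLo" "h \<in> PLo" using g h subgroupD(2)[OF G] by auto
  let ?S = "{u. g u = u} \<inter> {u. h u = u}"
  have hb: "h b \<noteq> b" using h(2) abcd by (auto simp: orbital_def)
  have S: "closed ?S" "b \<notin> ?S" "0 \<in> ?S" "1 \<in> ?S"
    using hb by (simp_all add: PLo_outside PL closed_Int closed_fixed_points PLo_continuous_on)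
  have b: "0 < b" "b < 1" using hb PLo_outside[OF PL(2), of b] by (meson not_le)+
  obtain x y where xy: "x \<in> ?S" "y \<in> ?S" "0 \<le> x" "x < b" "b < y" "y \<le> 1" "{x<..<y} \<inter> ?S = {}"
    by (rule closed_gap[OF S(1,2,3) b(1) S(4) b(2)])
  \<comment> \<open>The two crossing orbitals cover (a, d), which therefore fits between
    \<open>x\<close> and \<open>y\<close>.\<close>
  have disj: "u \<notin> ?S" if "a < u" "u < d" for u
  proof (cases "u < b")
    case True
    then show ?thesis using that g(2) by (simp add: orbital_def)
  next
    case False
    then show ?thesis using that h(2) abcd by (simp add: orbital_def)
  qed
  have "\<not> a < x" using disj[of x] xy(1,4) abcd by (meson less_trans)
  moreover have "\<not> y < d" using disj[of y] xy(2,5) abcd by (meson less_trans)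
  ultimately have "x \<le> a" "d \<le> y" by simp_all
  define H where "H = stabilizer G x y"
  have H: "PLo_subgroup H" unfolding H_def by (rule stabilizer_subgroup) fact
  have gH: "g \<in> H" "h \<in> H" using g(1) h(1) xy(1,2) by (simp_all add: H_def stabilizer_def)
  have HD: "\<forall>k\<in>H. k x = x" "\<forall>k\<in>H. k y = y" "H \<subseteq> G"
    by (auto simp: H_def stabilizer_def)
  have "moves_all (PLo_derived H) x y"
  proof (rule crossing_derived_moves_all[OF H HD(1)])
    show "g u \<noteq> u \<or> h u \<noteq> u" if "x < u" "u < y" for u
    proof -
      have "u \<notin> ?S" using xy(7) that by (meson disjoint_iff greaterThanLessThan_iff)
      then show ?thesis by simp
    qed
  qed fact+
  moreover have "k x = x \<and> k y = y \<and>
      (\<forall>\<^sub>F z in at_right x. k z = z) \<and> (\<forall>\<^sub>F z in at_left y. k z = z)"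
    if k: "k \<in> PLo_derived H" for k
  proof (intro conjI)
    have "k \<in> H" using derived_subgroup(2)[OF H] k by (rule subsetD)
    then show "k x = x" "k y = y" by (rule bspec[OF HD(1)] bspec[OF HD(2)])+
    show "\<forall>\<^sub>F z in at_right x. k z = z"
      by (rule derived_trivial_germ[OF H HD(1) _ k]) simp_all
    show "\<forall>\<^sub>F z in at_left y. k z = z"
      by (rule derived_trivial_germ[OF H HD(2) _ k]) simp_all
  qed
  ultimately have "compactly_moving (PLo_derived H) x y"
    using less_trans[OF xy(4,5)] derived_subgroup(1)[OF H] unfolding compactly_moving_def by blast
  moreover have "PLo_derived H \<subseteq> G" using derived_subgroup(2)[OF H] HD(3) by blast
  ultimately show thesis using that by blast
qed

text \<open>Any point of the interval is still moved by the iterated derived subgroup of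
  \<open>K\<close>, which lies in that of \<open>G\<close>.\<close>

lemma crossing_derived_power_nontrivial:
  assumes G: "PLo_subgroup G" and "crossing G"
  shows "(PLo_derived ^^ n) G \<noteq> {id}"
proof -
  obtain K x y where K: "K \<subseteq> G" "compactly_moving K x y"
    by (rule crossing_obtains_subgroup[OF assms])
  note D = compactly_movingD[OF K(2)]
  obtain u where u: "x < u" "u < y" using dense D(2) by blast
  have "moves_all ((PLo_derived ^^ n) K) x y"
    by (rule derived_power_moves_all[OF D(1,3,4,5)])
  then obtain k where k: "k \<in> (PLo_derived ^^ n) K" "k u \<noteq> u"
    using u unfolding moves_all_def by blast
  then have "k \<in> (PLo_derived ^^ n) G" using derived_power_mono[OF K(1)] by blast
  with k(2) show ?thesis by auto
qed

subsection \<open>Chains of orbitals\<close>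

text \<open>A finite tower with its group elements forgotten; \<open>less_depth_iff_chain\<close>
  recovers the depth from such chains.\<close>

definition orbital_chain :: "(real \<Rightarrow> real) set \<Rightarrow> real set set \<Rightarrow> bool" where
  "orbital_chain G C \<longleftrightarrow> finite C \<and> C \<subseteq> (\<Union>g\<in>G. orbitals g) \<and>
     (\<forall>A\<in>C. \<forall>B\<in>C. A \<subseteq> B \<or> B \<subseteq> A)"

lemma orbital_chain_insert:
  assumes "orbital_chain G C" "g \<in> G" "A \<in> orbitals g" "\<And>B. B \<in> C \<Longrightarrow> A \<subseteq> B \<or> B \<subseteq> A"
  shows "orbital_chain G (insert A C)"
  using assms unfolding orbital_chain_def by auto

text \<open>Every compact part of the interval lies in an orbital of a single element, whose closure
  lies in the interval again.\<close>

lemma crossing_chain: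
  assumes G: "PLo_subgroup G" and "crossing G"
  shows "\<exists>C. orbital_chain G C \<and> card C = n"
proof -
  obtain K x y where K: "K \<subseteq> G" "compactly_moving K x y"
    by (rule crossing_obtains_subgroup[OF assms])
  note D = compactly_movingD[OF K(2)]
  \<comment> \<open>The induction also carries an interval enclosing all orbitals so far, to be
    swallowed by the next one. The empty chain starts with \<open>u = v\<close>.\<close>
  have "\<exists>C u v. orbital_chain G C \<and> card C = n \<and> x < u \<and> u \<le> v \<and> v < y \<and> (\<forall>A\<in>C. A \<subseteq> {u<..<v})"
  proof (induction n)
    case 0
    obtain u where "x < u" "u < y" using dense D(2) by blast
    then show ?case
      by (intro exI[of _ "{}"] exI[of _ u]) (simp add: orbital_chain_def)
  next
    case (Suc n)
    then obtain C u v where C: "orbital_chain G C" "card C = n" "\<forall>A\<in>C. A \<subseteq> {u<..<v}"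
      and uv: "x < u" "u \<le> v" "v < y" by blast
    have "\<exists>k\<in>K. v < k u"
      by (rule orbit_unbounded_above[OF D(1), of x y]) (use D(3) uv in \<open>auto simp: moves_all_def\<close>)
    then obtain k where k: "k \<in> K" "v < k u" by blast
    have PL: "k \<in> PLo" using subgroupD(2)[OF D(1) k(1)] .
    have "k u \<noteq> u" using k(2) uv(2) by linarith
    then obtain p q where pq: "orbital k p q" "p < u" "u < q"
      by (rule orbital_exists[OF PL])
    \<comment> \<open>An element preserves its own orbitals, so \<open>k u\<close> and with it
      \<open>v\<close> stay to the left of \<open>q\<close>.\<close>
    have "v < q" using orbital_less_right_end[OF PL pq(1), of u] k(2) pq by linarith
    \<comment> \<open>Near \<open>x\<close> and \<open>y\<close> the element \<open>k\<close> is
      trivial, which forces the orbital to end strictly inside (x, y).\<close>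
    obtain e where e: "x < e" "\<And>z. x < z \<Longrightarrow> z < e \<Longrightarrow> k z = z"
      using bspec[OF D(5) k(1)] unfolding eventually_at_right_field by blast
    obtain e' where e': "e' < y" "\<And>z. e' < z \<Longrightarrow> z < y \<Longrightarrow> k z = z"
      using bspec[OF D(6) k(1)] unfolding eventually_at_left_field by blast
    have moved: "k z \<noteq> z" if "p < z" "z < q" for z using pq(1) that by (auto simp: orbital_def)
    have "x < p"
    proof (rule ccontr)
      assume "\<not> x < p"
      obtain z where "x < z" "z < min e u" using dense[of x "min e u"] e(1) uv by auto
      then show False using moved[of z] e(2)[of z] \<open>\<not> x < p\<close> pq by simp
    qed
    have "q < y"
    proof (rule ccontr)
      assume "\<not> q < y"
      obtain z where "max e' u < z" "z < y" using dense[of "max e' u" y] e'(1) uv by auto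
      then show False using moved[of z] e'(2)[of z] \<open>\<not> q < y\<close> pq by simp
    qed
    let ?A = "{p<..<q}"
    have sub: "{u<..<v} \<subseteq> ?A" using pq \<open>v < q\<close> by auto
    have "\<not> ?A \<subseteq> {u<..<v}" using pq by auto
    then have "?A \<notin> C" using C(3) by blast
    then have "card (insert ?A C) = Suc n" using C by (simp add: orbital_chain_def)
    moreover have "orbital_chain G (insert ?A C)"
    proof (rule orbital_chain_insert[OF C(1)])
      show "k \<in> G" using k(1) K(1) by blast
      show "?A \<in> orbitals k" using orbitals_iff[OF PL] pq(1) by blast
      show "?A \<subseteq> B \<or> B \<subseteq> ?A" if "B \<in> C" for B using C(3) sub that by blast
    qed
    moreover have "\<forall>A\<in>insert ?A C. A \<subseteq> {p<..<q}" using C(3) sub by blast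
    moreover have "p \<le> q" using pq by simp
    ultimately show ?case using \<open>x < p\<close> \<open>q < y\<close> by (intro exI conjI)
  qed
  then show ?thesis by blast
qed

subsection \<open>Groups without crossing orbitals\<close>

lemma crossing_mono: "crossing H \<Longrightarrow> H \<subseteq> G \<Longrightarrow> crossing G"
  unfolding crossing_def by blast

lemma orbital_moves: "orbital f a b \<Longrightarrow> a < x \<Longrightarrow> x < b \<Longrightarrow> f x \<noteq> x"
  by (simp add: orbital_def)

lemma orbital_endpoints:
  "orbital f a b \<Longrightarrow> a < b" "orbital f a b \<Longrightarrow> f a = a" "orbital f a b \<Longrightarrow> f b = b"
  by (simp_all add: orbital_def)

lemma orbital_stops_at_fixed:
  assumes "orbital f a b" "f x = x"
  shows "x \<le> a \<or> b \<le> x"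
  using orbital_moves[OF assms(1), of x] assms(2) by linarith

text \<open>Some \<open>k\<close> fixing \<open>a\<close> takes \<open>b\<close> into (a, b), so it
  does not commute with \<open>g\<close> at \<open>b\<close>, and the derived subgroup of the
  stabilizer of \<open>a\<close> moves \<open>b\<close>. A germ there is trivial at
  \<open>a\<close>, so the resulting orbital around \<open>b\<close> begins to the right of
  \<open>a\<close> and crosses (a, b).\<close>

lemma shared_left_endpoint_crossing:
  assumes G: "PLo_subgroup G" and g: "g \<in> G" "orbital g a b" and h: "h \<in> G" "orbital h a c"
    and bc: "b < c"
  shows "crossing G"
proof -
  have ab: "a < b" by (rule orbital_endpoints(1)) fact
  obtain k where k: "k \<in> G" "k a = a" "k b < b"
    using orbital_push_left[OF G h ab bc ab] by blast
  define H where "H = stabilizer G a a"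
  have H: "PLo_subgroup H" "H \<subseteq> G" "\<forall>k\<in>H. k a = a"
    unfolding H_def by (rule stabilizer_subgroup[OF G]) (auto simp: stabilizer_def)
  have gk: "g \<in> H" "k \<in> H"
    using g(1) k(1,2) orbital_endpoints(2)[OF g(2)] by (simp_all add: H_def stabilizer_def)
  have "a < k b" using PLo_less_iff[OF subgroupD(2)[OF G k(1)], of a b] k(2) ab by simp
  then have "g (k b) \<noteq> k (g b)"
    using orbital_moves[OF g(2) _ k(3)] orbital_endpoints(3)[OF g(2)] by simp
  then have "b \<notin> commuting_points H" using gk unfolding commuting_points_def by blast
  then obtain f where f: "f \<in> PLo_derived H" "f b \<noteq> b" using derived_moves_point[OF H(1)] by blast
  have fG: "f \<in> G" using f(1) derived_subgroup(2)[OF H(1)] H(2) by blast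
  obtain p q where pq: "orbital f p q" "p < b" "b < q"
    by (rule orbital_exists[OF subgroupD(2)[OF G fG] f(2)])
  have "\<forall>\<^sub>F z in at_right a. f z = z"
    by (rule derived_trivial_germ[OF H(1,3) _ f(1)]) simp
  then obtain e where e: "a < e" "\<And>z. a < z \<Longrightarrow> z < e \<Longrightarrow> f z = z"
    unfolding eventually_at_right_field by blast
  obtain z where z: "a < z" "z < min e b" using dense[of a "min e b"] e(1) ab by auto
  have "a < p" using orbital_stops_at_fixed[OF pq(1) e(2)[of z]] z pq by auto
  then show ?thesis using crossingI[OF g(1) fG g(2) pq(1)] pq by blast
qed

text \<open>Mirror image of the preceding argument, with \<open>a\<close> pushed to the right and
  the trivial germ at \<open>b\<close>.\<close>

lemma shared_right_endpoint_crossing: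
  assumes G: "PLo_subgroup G" and g: "g \<in> G" "orbital g a b" and h: "h \<in> G" "orbital h c b"
    and ca: "c < a"
  shows "crossing G"
proof -
  have ab: "a < b" by (rule orbital_endpoints(1)) fact
  obtain k where k: "k \<in> G" "k b = b" "a < k a"
    using orbital_push_right[OF G h ca ca ab] by blast
  define H where "H = stabilizer G b b"
  have H: "PLo_subgroup H" "H \<subseteq> G" "\<forall>k\<in>H. k b = b"
    unfolding H_def by (rule stabilizer_subgroup[OF G]) (auto simp: stabilizer_def)
  have gk: "g \<in> H" "k \<in> H"
    using g(1) k(1,2) orbital_endpoints(3)[OF g(2)] by (simp_all add: H_def stabilizer_def)
  have "k a < b" using PLo_less_iff[OF subgroupD(2)[OF G k(1)], of a b] k(2) ab by simp
  then have "g (k a) \<noteq> k (g a)"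
    using orbital_moves[OF g(2) k(3)] orbital_endpoints(2)[OF g(2)] by simp
  then have "a \<notin> commuting_points H" using gk unfolding commuting_points_def by blast
  then obtain f where f: "f \<in> PLo_derived H" "f a \<noteq> a" using derived_moves_point[OF H(1)] by blast
  have fG: "f \<in> G" using f(1) derived_subgroup(2)[OF H(1)] H(2) by blast
  obtain p q where pq: "orbital f p q" "p < a" "a < q"
    by (rule orbital_exists[OF subgroupD(2)[OF G fG] f(2)])
  have "\<forall>\<^sub>F z in at_left b. f z = z"
    by (rule derived_trivial_germ[OF H(1,3) _ f(1)]) simp
  then obtain e where e: "e < b" "\<And>z. e < z \<Longrightarrow> z < b \<Longrightarrow> f z = z"
    unfolding eventually_at_left_field by blast
  obtain z where z: "max e a < z" "z < b" using dense[of "max e a" b] e(1) ab by auto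
  have "q < b" using orbital_stops_at_fixed[OF pq(1) e(2)[of z]] z pq by auto
  then show ?thesis using crossingI[OF fG g(1) pq(1) g(2)] pq by blast
qed

text \<open>If \<open>g\<close> moved \<open>c\<close>, its orbital around \<open>c\<close> would
  end by \<open>a\<close> and cross (c, d). A slope other than 1 at \<open>c\<close> would give an
  orbital of \<open>g\<close> starting at \<open>c\<close> and ending before \<open>d\<close>, hence
  a crossing by the shared endpoint.\<close>

lemma nested_trivial_germ:
  assumes G: "PLo_subgroup G" and nc: "\<not> crossing G"
    and g: "g \<in> G" "g a = a" and h: "h \<in> G" "orbital h c d" and ca: "c < a" "a < d"
  shows "\<forall>\<^sub>F z in at_right c. g z = z"
proof -
  have PL: "g \<in> PLo" by (rule subgroupD(2)[OF G g(1)])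
  have gc: "g c = c"
  proof (rule ccontr)
    assume "g c \<noteq> c"
    then obtain u v where uv: "orbital g u v" "u < c" "c < v" by (rule orbital_exists[OF PL])
    have "v \<le> a" using orbital_stops_at_fixed[OF uv(1) g(2)] uv ca by linarith
    then show False using crossingI[OF g(1) h(1) uv(1) h(2)] uv ca nc by simp
  qed
  obtain m where "\<forall>\<^sub>F z in at_right c. g z = g c + m * (z - c)"
    using PLo_germ_right[OF PL] by blast
  then obtain e where e: "c < e" "\<And>z. c < z \<Longrightarrow> z < e \<Longrightarrow> g z = c + m * (z - c)"
    unfolding eventually_at_right_field gc by blast
  have "m = 1"
  proof (rule ccontr)
    assume "m \<noteq> 1"
    have moved: "g z \<noteq> z" if "c < z" "z < e" for z
    proof
      assume "g z = z"
      then have "(m - 1) * (z - c) = 0" using e(2)[OF that] by (simp add: algebra_simps)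
      with \<open>m \<noteq> 1\<close> that show False by simp
    qed
    obtain z where z: "c < z" "z < min e a" using dense[of c "min e a"] e(1) ca by auto
    then obtain u v where uv: "orbital g u v" "u < z" "z < v"
      using orbital_exists[OF PL moved[of z]] by auto
    \<comment> \<open>The fixed point \<open>c\<close> bounds the orbital from the left, and no
      point shortly after \<open>c\<close> is fixed, so the orbital begins exactly at
      \<open>c\<close>.\<close>
    have "c \<le> u" using orbital_stops_at_fixed[OF uv(1) gc] uv z by linarith
    moreover have "\<not> c < u"
      using moved[of u] orbital_endpoints(2)[OF uv(1)] uv z by auto
    ultimately have "orbital g c v" using uv(1) by simp
    moreover have "v \<le> a" using orbital_stops_at_fixed[OF uv(1) g(2)] uv z by auto
    ultimately show False
      using shared_left_endpoint_crossing[OF G g(1) _ h, of v] ca nc by simp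
  qed
  then show ?thesis
    using e unfolding eventually_at_right_field by (intro exI[of _ e]) simp
qed

text \<open>A suitable conjugate of g is trivial on the inner orbital, so a commutator agrees with g
  there.\<close>

lemma nested_orbital_derived:
  assumes G: "PLo_subgroup G" and nc: "\<not> crossing G"
    and g: "g \<in> G" "orbital g a b" and h: "h \<in> G" "orbital h c d"
    and sub: "{a<..<b} \<subset> {c<..<d}"
  shows "\<exists>f\<in>PLo_derived G. orbital f a b"
proof -
  have ab: "a < b" by (rule orbital_endpoints(1)) fact
  have le: "c \<le> a" "b \<le> d"
    using sub ab greaterThanLessThan_subseteq_greaterThanLessThan[of a b c d] by auto
  \<comment> \<open>A shared endpoint of properly nested orbitals would force a crossing, so both
    ends are strict.\<close>
  have "c \<noteq> a"
    using shared_left_endpoint_crossing[OF G g h(1), of d] h(2) nc le sub by force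
  have "b \<noteq> d"
    using shared_right_endpoint_crossing[OF G g h(1), of c] h(2) nc le sub by force
  with \<open>c \<noteq> a\<close> le have cd: "c < a" "b < d" by simp_all
  have "\<forall>\<^sub>F z in at_right c. g z = z"
    by (rule nested_trivial_germ[OF G nc g(1) orbital_endpoints(2)[OF g(2)] h]) (use cd ab in simp_all)
  then obtain e where e: "c < e" "\<And>z. c < z \<Longrightarrow> z < e \<Longrightarrow> g z = z"
    unfolding eventually_at_right_field by blast
  \<comment> \<open>The whole of [a, b] is carried by \<open>k\<close> into (c, e), where
    \<open>g\<close> is trivial.\<close>
  obtain k where k: "k \<in> G" "k c = c" "k b < e"
    using orbital_push_left[OF G h, of b e] cd ab e(1) by auto
  have PL: "g \<in> PLo" "k \<in> PLo" using g k subgroupD(2)[OF G] by blast+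
  define f where "f = finv k \<circ> (finv g \<circ> (k \<circ> g))"
  have f_eq: "f x = g x" if "a \<le> x" "x \<le> b" for x
  proof -
    have "a \<le> g x" "g x \<le> b"
      using PLo_le_iff[OF PL(1), of a x] PLo_le_iff[OF PL(1), of x b] that
        orbital_endpoints(2,3)[OF g(2)] by auto
    then have "c < k (g x)" "k (g x) < e"
      using PLo_less_iff[OF PL(2), of c "g x"] PLo_le_iff[OF PL(2), of "g x" b] k cd by auto
    then have "finv g (k (g x)) = k (g x)" using finv_fixed[OF PL(1)] e(2) by blast
    then show ?thesis using PL by (simp add: f_def)
  qed
  have "orbital f a b" using g(2) f_eq ab by (simp add: orbital_def)
  moreover have "f \<in> PLo_derived G" unfolding f_def by (rule commutator_in_derived[OF G g(1) k(1)])
  ultimately show ?thesis by blast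
qed

text \<open>Some \<open>g\<close> moves \<open>a\<close>, as otherwise \<open>f\<close> would be
  trivial just to the right of \<open>a\<close>. The orbital of \<open>g\<close> around
  \<open>a\<close> cannot end before \<open>b\<close> without a crossing.\<close>

lemma derived_orbital_extends:
  assumes G: "PLo_subgroup G" and nc: "\<not> crossing G"
    and f: "f \<in> PLo_derived G" "orbital f a b"
  shows "\<exists>g\<in>G. \<exists>c d. orbital g c d \<and> {a<..<b} \<subset> {c<..<d}"
proof -
  have ab: "a < b" by (rule orbital_endpoints(1)) fact
  have fG: "f \<in> G" using f(1) derived_subgroup(2)[OF G] by blast
  have "\<exists>g\<in>G. g a \<noteq> a"
  proof (rule ccontr)
    assume "\<not> ?thesis"
    then have fixed: "\<forall>g\<in>G. g a = a" by blast
    have "\<forall>\<^sub>F z in at_right a. f z = z"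
      by (rule derived_trivial_germ[OF G fixed _ f(1)]) simp
    then obtain e where e: "a < e" "\<And>z. a < z \<Longrightarrow> z < e \<Longrightarrow> f z = z"
      unfolding eventually_at_right_field by blast
    obtain z where "a < z" "z < min e b" using dense[of a "min e b"] e(1) ab by auto
    then show False using e(2)[of z] orbital_moves[OF f(2), of z] by simp
  qed
  then obtain g where g: "g \<in> G" "g a \<noteq> a" by blast
  obtain c d where cd: "orbital g c d" "c < a" "a < d"
    by (rule orbital_exists[OF subgroupD(2)[OF G g(1)] g(2)])
  have "\<not> d < b" using crossingI[OF g(1) fG cd(1) f(2) cd(2,3)] nc by blast
  moreover have "a \<in> {c<..<d}" "a \<notin> {a<..<b}" using cd by auto
  ultimately have "{a<..<b} \<subset> {c<..<d}" using cd by auto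
  with g(1) cd(1) show ?thesis by blast
qed

text \<open>Removing the largest orbital leaves orbitals properly inside it, which are orbitals of
  the derived subgroup by \<open>nested_orbital_derived\<close>. One orbital must survive, hence
  \<open>Suc n\<close> of them for \<open>n\<close> derivations.\<close>

lemma chain_derived_power_nontrivial:
  assumes "PLo_subgroup G" "\<not> crossing G" "orbital_chain G C" "card C = Suc n"
  shows "(PLo_derived ^^ n) G \<noteq> {id}"
  using assms
proof (induction n arbitrary: G C)
  case 0
  then obtain A where "A \<in> C" by fastforce
  then obtain g where g: "g \<in> G" "A \<in> orbitals g" using 0(3) by (auto simp: orbital_chain_def)
  have "g \<noteq> id" using g(2) by (auto simp: orbitals_def supp_def)
  with g(1) show ?case by auto
next
  case (Suc n)
  have C: "finite C" "C \<noteq> {}" "\<And>A B. A \<in> C \<Longrightarrow> B \<in> C \<Longrightarrow> A \<subseteq> B \<or> B \<subseteq> A"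
    and orb: "\<And>A. A \<in> C \<Longrightarrow> \<exists>g\<in>G. A \<in> orbitals g"
    using Suc.prems(3,4) by (auto simp: orbital_chain_def)
  obtain M where M: "M \<in> C" "\<And>B. B \<in> C \<Longrightarrow> M \<subseteq> B \<Longrightarrow> M = B"
    using finite_has_maximal[OF C(1,2)] by blast
  have D: "PLo_subgroup (PLo_derived G)" "PLo_derived G \<subseteq> G"
    by (rule derived_subgroup[OF Suc.prems(1)])+
  have "\<exists>f\<in>PLo_derived G. A \<in> orbitals f" if A: "A \<in> C" "A \<noteq> M" for A
  proof -
    have "A \<subset> M" using C(3)[OF A(1) M(1)] M(2)[OF A(1)] A(2) by blast
    obtain g h where g: "g \<in> G" "A \<in> orbitals g" and h: "h \<in> G" "M \<in> orbitals h"
      using orb A(1) M(1) by blast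
    have PL: "k \<in> PLo" if "k \<in> G" for k by (rule subgroupD(2)[OF Suc.prems(1) that])
    obtain a b c d where ab: "orbital g a b" "A = {a<..<b}" and cd: "orbital h c d" "M = {c<..<d}"
      using g h orbitals_iff[OF PL] by metis
    obtain f where f: "f \<in> PLo_derived G" "orbital f a b"
      using nested_orbital_derived[OF Suc.prems(1,2) g(1) ab(1) h(1) cd(1)] \<open>A \<subset> M\<close> ab(2) cd(2)
      by blast
    have "f \<in> PLo" using f(1) D(2) PL by blast
    then show ?thesis using f orbitals_iff[of f] ab(2) by blast
  qed
  then have "orbital_chain (PLo_derived G) (C - {M})"
    using C(1,3) unfolding orbital_chain_def by blast
  moreover have "card (C - {M}) = Suc n" using Suc.prems(4) M(1) C(1) by simp
  moreover have "\<not> crossing (PLo_derived G)" using crossing_mono D(2) Suc.prems(2) by blast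
  ultimately have "(PLo_derived ^^ n) (PLo_derived G) \<noteq> {id}" using Suc.IH D(1) by blast
  \<comment> \<open>The derivation used up is the first one applied to \<open>G\<close>, so the
    power is unfolded on the right.\<close>
  then show ?case by (simp only: funpow_Suc_right o_apply not_False_eq_True)
qed

text \<open>The last derivation is undone by enclosing the orbital in a larger one, above which the
  chain exists by induction. Keeping (a, b) inside every member allows it to be added at the
  bottom.\<close>

lemma derived_power_orbital_chain:
  assumes G: "PLo_subgroup G" and nc: "\<not> crossing G"
    and "f \<in> (PLo_derived ^^ n) G" "orbital f a b"
  shows "\<exists>C. orbital_chain G C \<and> card C = Suc n \<and> (\<forall>B\<in>C. {a<..<b} \<subseteq> B)"
  using assms(3,4)
proof (induction n arbitrary: f a b)
  case 0
  have "{a<..<b} \<in> orbitals f" using 0 orbitals_iff subgroupD(2)[OF G] by auto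
  with 0 show ?case by (intro exI[of _ "{{a<..<b}}"]) (auto simp: orbital_chain_def)
next
  case (Suc n)
  let ?D = "(PLo_derived ^^ n) G"
  have D: "PLo_subgroup ?D" "?D \<subseteq> G" by (rule derived_power_subgroup[OF G])+
  have f: "f \<in> PLo_derived ?D" using Suc.prems(1) by simp
  have fG: "f \<in> G" using f derived_subgroup(2)[OF D(1)] D(2) by blast
  have "\<not> crossing ?D" using crossing_mono D(2) nc by blast
  then obtain g c d where g: "g \<in> ?D" "orbital g c d" "{a<..<b} \<subset> {c<..<d}"
    using derived_orbital_extends[OF D(1) _ f Suc.prems(2)] by blast
  obtain C where C: "orbital_chain G C" "card C = Suc n" "\<forall>B\<in>C. {c<..<d} \<subseteq> B"
    using Suc.IH[OF g(1,2)] by blast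
  let ?A = "{a<..<b}"
  have "?A \<in> orbitals f" using orbitals_iff[OF subgroupD(2)[OF G fG]] Suc.prems(2) by blast
  then have "orbital_chain G (insert ?A C)"
    using C(3) g(3) by (intro orbital_chain_insert[OF C(1) fG]) blast+
  moreover have "?A \<notin> C" using C(3) g(3) by blast
  then have "card (insert ?A C) = Suc (Suc n)" using C(1,2) by (simp add: orbital_chain_def)
  moreover have "\<forall>B\<in>insert ?A C. ?A \<subseteq> B" using C(3) g(3) by blast
  ultimately show ?case by blast
qed

subsection \<open>Depth and derived length\<close>

text \<open>A tower of height above \<open>n\<close>, finite or not, contains \<open>n + 1\<close>
  signed orbitals, and their orbitals are distinct. Conversely, choosing one element for each
  orbital of a chain gives a tower.\<close>

lemma less_depth_iff_chain: "enat n < depth G \<longleftrightarrow> (\<exists>C. orbital_chain G C \<and> card C = Suc n)"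
proof
  assume "enat n < depth G"
  then obtain T where T: "tower G T" "enat n < height T"
    unfolding depth_def less_SUP_iff by blast
  obtain U where U: "U \<subseteq> T" "finite U" "card U = Suc n"
  proof (cases "finite T")
    case True
    then show thesis
      using T(2) that obtain_subset_with_card_n[of "Suc n" T] by (auto simp: height_def)
  next
    case False
    then show thesis using that infinite_arbitrarily_large[of T "Suc n"] by blast
  qed
  have "inj_on fst U" using T(1) U(1) unfolding tower_def inj_on_def by blast
  then have "card (fst ` U) = Suc n" using U(3) by (simp add: card_image)
  moreover have "orbital_chain G (fst ` U)"
    using T(1) U(1,2) unfolding orbital_chain_def tower_def signed_orbital_def by blast
  ultimately show "\<exists>C. orbital_chain G C \<and> card C = Suc n" by blast
next
  assume "\<exists>C. orbital_chain G C \<and> card C = Suc n"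
  then obtain C where C: "orbital_chain G C" "card C = Suc n" by blast
  then have "\<forall>A\<in>C. \<exists>g. g \<in> G \<and> A \<in> orbitals g" by (auto simp: orbital_chain_def)
  then obtain g where g: "\<forall>A\<in>C. g A \<in> G \<and> A \<in> orbitals (g A)" by metis
  let ?T = "(\<lambda>A. (A, g A)) ` C"
  have "tower G ?T"
    using C(1) g by (auto simp: orbital_chain_def tower_def signed_orbital_def)
  moreover have "card ?T = Suc n" using C(2) by (simp add: card_image inj_on_def)
  then have "enat n < height ?T" using C(1) by (auto simp: height_def orbital_chain_def)
  ultimately show "enat n < depth G" unfolding depth_def less_SUP_iff by blast
qed

text \<open>With a crossing both sides hold for every \<open>n\<close>; without one, chains and
  derivations correspond step by step.\<close>

lemma less_depth_iff_derived:
  assumes G: "PLo_subgroup G"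
  shows "enat n < depth G \<longleftrightarrow> (PLo_derived ^^ n) G \<noteq> {id}"
proof (cases "crossing G")
  case True
  then show ?thesis
    using crossing_derived_power_nontrivial[OF G] crossing_chain[OF G]
    by (simp add: less_depth_iff_chain)
next
  case False
  show ?thesis
    unfolding less_depth_iff_chain
  proof
    assume "\<exists>C. orbital_chain G C \<and> card C = Suc n"
    then show "(PLo_derived ^^ n) G \<noteq> {id}"
      using chain_derived_power_nontrivial[OF G False] by blast
  next
    assume nontrivial: "(PLo_derived ^^ n) G \<noteq> {id}"
    have D: "PLo_subgroup ((PLo_derived ^^ n) G)" by (rule derived_power_subgroup[OF G])
    then obtain f where f: "f \<in> (PLo_derived ^^ n) G" "f \<noteq> id"
      using nontrivial subgroupD(1)[OF D] by blast
    then obtain x where "f x \<noteq> x" by (auto simp: fun_eq_iff)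
    then obtain a b where "orbital f a b"
      using orbital_exists[OF subgroupD(2)[OF D f(1)]] by blast
    with derived_power_orbital_chain[OF G False f(1)]
    show "\<exists>C. orbital_chain G C \<and> card C = Suc n" by blast
  qed
qed

text \<open>Solvability refers to \<open>G\<close> as a group of its own, whose derived series
  agrees with the one formed in \<open>PLo_group\<close>.\<close>

lemma derived_power_trivial_imp_solvable:
  assumes G: "PLo_subgroup G" and "(PLo_derived ^^ n) G = {id}"
  shows "solvable (PLo_group\<lparr>carrier := G\<rparr>)"
proof -
  let ?G = "PLo_group\<lparr>carrier := G\<rparr>"
  interpret GG: group ?G by (rule PLo.subgroup_imp_group) fact
  have "(derived ?G ^^ m) G = (PLo_derived ^^ m) G" for m
    by (induction m)
      (simp_all add: PLo.derived_consistent[OF derived_power_subgroup(2)[OF G] G])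
  then have "(derived ?G ^^ n) G = {\<one>\<^bsub>?G\<^esub>}" using assms(2) by simp
  then have "solvable_seq ?G G"
    using GG.trivial_derived_seq_imp_solvable[OF GG.subgroup_self] by simp
  then show ?thesis by (simp add: solvable_def)
qed

theorem theorem5:
  fixes G :: "(real \<Rightarrow> real) set" and n :: nat
  assumes "subgroup G PLo_group"
  shows "(solvable (PLo_group\<lparr>carrier := G\<rparr>) \<and> has_derived_length G n) \<longleftrightarrow> depth G = enat n"
proof -
  \<comment> \<open>Strict comparisons with finite values determine the depth; the first conjunct
    rules out \<infinity>.\<close>
  have "depth G = enat n \<longleftrightarrow> \<not> enat n < depth G \<and> (\<forall>k<n. enat k < depth G)"
  proof (cases "depth G")
    case (enat d)
    then show ?thesis by (metis enat_ord_simps(2) less_irrefl nat_neq_iff enat.inject)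
  qed simp
  then have "depth G = enat n \<longleftrightarrow> has_derived_length G n"
    by (simp add: less_depth_iff_derived[OF assms] has_derived_length_def)
  then show ?thesis
    using derived_power_trivial_imp_solvable[OF assms] by (auto simp: has_derived_length_def)
qed

end
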